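(* Suppose $G$ is a finite simple graph on $n$ vertices whose adjacency matrix has at most one eigenvalue (counted with multiplicity) different from $-2$ and $0$. Then $G=nK_1$, or $G=K_{1,4}+(n-5)K_1$, or $G=CP(k)+(n-2k)K_1$ for some $k\geq 2$.
   Context: $G+G'$ denotes the disjoint union of graphs, $mG$ denotes $m$ disjoint copies of $G$, and $K_1$ is the single vertex. $CP(k)$ (the cocktail party graph) is the complete $k$-partite graph with all $k$ classes of size $2$. *)

theory Defs
  imports
    "Graph_Theory.Graph_Theory"
    "Jordan_Normal_Form.Char_Poly"
    "HOL.Complex"
begin

text \<open>
  Finite simple graphs are the symmetric, loop-free, finite digraphs described by
  \<^locale>\<open>pair_graph\<close>: an undirected edge is represented by both of its orientations.
\<close>

definition disjoint_union ::
    "'a pair_pre_digraph \<Rightarrow> 'b pair_pre_digraph \<Rightarrow> ('a + 'b) pair_pre_digraph"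
  where "disjoint_union G H =
    \<lparr> pverts = pverts G <+> pverts H,
      parcs = {(Inl u, Inl v) | u v. (u, v) \<in> parcs G} \<union> {(Inr u, Inr v) | u v. (u, v) \<in> parcs H} \<rparr>"

definition copies :: "nat \<Rightarrow> 'a pair_pre_digraph \<Rightarrow> (nat \<times> 'a) pair_pre_digraph"
  where "copies m G =
    \<lparr> pverts = {..<m} \<times> pverts G,
      parcs = {((i, u), (i, v)) | i u v. i < m \<and> (u, v) \<in> parcs G} \<rparr>"

definition single_vertex :: "unit pair_pre_digraph"
  where "single_vertex = \<lparr> pverts = {()}, parcs = {} \<rparr>"

text \<open>The vertex \<open>(i, j)\<close> is the \<open>j\<close>-th element of the \<open>i\<close>-th class; \<open>ns\<close> lists the class sizes.\<close>

definition complete_multipartite :: "nat list \<Rightarrow> (nat \<times> nat) pair_pre_digraph"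
  where "complete_multipartite ns =
    (let V = {(i, j). i < length ns \<and> j < ns ! i}
     in \<lparr> pverts = V, parcs = {(u, v). u \<in> V \<and> v \<in> V \<and> fst u \<noteq> fst v} \<rparr>)"

definition complete_bipartite :: "nat \<Rightarrow> nat \<Rightarrow> (nat \<times> nat) pair_pre_digraph"
  where "complete_bipartite a b = complete_multipartite [a, b]"

definition cocktail_party :: "nat \<Rightarrow> (nat \<times> nat) pair_pre_digraph"
  where "cocktail_party k = complete_multipartite (replicate k 2)"

definition isomorphic :: "'a pair_pre_digraph \<Rightarrow> 'b pair_pre_digraph \<Rightarrow> bool"
  where "isomorphic G H \<longleftrightarrow> digraph_iso (with_proj G) (with_proj H)"

text \<open>
  The list \<open>vs\<close> enumerates the vertices, each exactly once; a different enumeration conjugates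
  the matrix by a permutation matrix.
\<close>

definition adjacency_matrix :: "'a pair_pre_digraph \<Rightarrow> 'a list \<Rightarrow> 'b :: zero_neq_one mat"
  where "adjacency_matrix G vs =
    mat (length vs) (length vs) (\<lambda>(i, j). if (vs ! i, vs ! j) \<in> parcs G then 1 else 0)"

definition eigenvalue_mset :: "complex mat \<Rightarrow> complex multiset"
  where "eigenvalue_mset A = proots (char_poly A)"

lemma pair_graph_complete_multipartite: "pair_graph (complete_multipartite ns)"
proof -
  let ?V = "{(i, j). i < length ns \<and> j < ns ! i}"
  have "?V = (SIGMA i:{..<length ns}. {..<ns ! i})" by auto
  then have fin: "finite ?V" by simp
  have "finite {(u, v). u \<in> ?V \<and> v \<in> ?V \<and> fst u \<noteq> fst v}"
    by (rule finite_subset[of _ "?V \<times> ?V"]) (use fin in auto)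
  with fin show ?thesis
    by unfold_locales
      (auto simp: complete_multipartite_def Let_def symmetric_def arcs_ends_conv intro!: symI)
qed

lemma complete_bipartite_digraph_complete_bipartite:
  "complete_bipartite_digraph a b (with_proj (complete_bipartite a b))"
proof -
  interpret pair_graph "complete_bipartite a b"
    unfolding complete_bipartite_def by (rule pair_graph_complete_multipartite)
  let ?U = "{0::nat} \<times> {..<a}" and ?V = "{1::nat} \<times> {..<b}"
  have *: "{(i, j). i < length [a, b] \<and> j < [a, b] ! i} = ?U \<union> ?V"
    by (auto simp: less_Suc_eq)
  have "pverts (complete_bipartite a b) = ?U \<union> ?V"
    "parcs (complete_bipartite a b) = ?U \<times> ?V \<union> ?V \<times> ?U"
    unfolding complete_bipartite_def complete_multipartite_def Let_def * by auto
  moreover have "card ?U = a" "card ?V = b" "?U \<inter> ?V = {}"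
    by (auto simp: card_cartesian_product)
  moreover have "graph (with_proj (complete_bipartite a b))" by unfold_locales
  ultimately show ?thesis
    unfolding complete_bipartite_digraph_def with_proj_simps by metis
qed

lemma complete_digraph_single_vertex: "complete_digraph 1 (with_proj single_vertex)"
  by (auto simp: complete_digraph_pair_def single_vertex_def)

end

(*
  Put B = A^2 + 2A. By triangularization B has at most one nonzero eigenvalue, counted with
  multiplicity, so B^2 - tr(B) B is symmetric with only zero eigenvalues and hence vanishes.
  Therefore B is, up to sign, positive semidefinite, and since the sum of its principal 2x2 minors
  is zero, each of them is zero: with d the degree and c the number of common neighbours,
  (c(u,v) + 2 [u ~ v])^2 = d(u) d(v).
  For nonadjacent nonisolated u and v this forces c(u,v) = d(u) = d(v), so u and v have the same
  neighbours and the nonisolated vertices induce a complete multipartite graph. For adjacent u and v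
  whose classes have sizes p and q it reads (s + 2)^2 = (s + p)(s + q), where s is the number of
  vertices outside these two classes; hence p = q = 2, or s = 0 and {p, q} = {1, 4}.
*)
theory Submission
  imports Defs "Jordan_Normal_Form.Schur_Decomposition" "HOL-Analysis.Convex"
begin

section \<open>Matrices triangularized by a common change of basis\<close>

text \<open>With \<open>P\<close> and \<open>Q\<close> fixed, the relation is preserved by sums,
  scalar multiples and products, so the eigenvalues \<open>f i\<close> of a polynomial in a matrix
  are computed index by index, with multiplicity.\<close>

definition triangularized_by :: "complex mat \<Rightarrow> complex mat \<Rightarrow> nat \<Rightarrow> complex mat \<Rightarrow> (nat \<Rightarrow> complex) \<Rightarrow> bool"
  where "triangularized_by P Q n M f \<longleftrightarrow>
    (\<exists>T \<in> carrier_mat n n. upper_triangular T \<and> M = P * T * Q \<and> (\<forall>i<n. T $$ (i, i) = f i))"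

context
  fixes P Q :: "complex mat" and n :: nat
  assumes P: "P \<in> carrier_mat n n" and Q: "Q \<in> carrier_mat n n" and QP: "Q * P = 1\<^sub>m n"
begin

lemma triangularized_by_carrier:
  "triangularized_by P Q n M f \<Longrightarrow> M \<in> carrier_mat n n"
  using P Q by (auto simp: triangularized_by_def)

lemma triangularized_by_add:
  assumes "triangularized_by P Q n M f" and "triangularized_by P Q n N g"
  shows "triangularized_by P Q n (M + N) (\<lambda>i. f i + g i)"
proof -
  obtain S T where S: "S \<in> carrier_mat n n" "upper_triangular S" "M = P * S * Q" "\<forall>i<n. S $$ (i, i) = f i"
    and T: "T \<in> carrier_mat n n" "upper_triangular T" "N = P * T * Q" "\<forall>i<n. T $$ (i, i) = g i"
    using assms by (auto simp: triangularized_by_def)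
  have "M + N = P * (S + T) * Q"
    using P Q S T by (simp add: mult_add_distrib_mat[of P n n] add_mult_distrib_mat[of _ n n _ Q n])
  moreover have "upper_triangular (S + T)"
    using S T by (intro upper_triangularI) (auto simp: upper_triangularD)
  ultimately show ?thesis
    using S T unfolding triangularized_by_def by (intro bexI[of _ "S + T"]) auto
qed

lemma triangularized_by_smult:
  assumes "triangularized_by P Q n M f"
  shows "triangularized_by P Q n (c \<cdot>\<^sub>m M) (\<lambda>i. c * f i)"
proof -
  obtain S where S: "S \<in> carrier_mat n n" "upper_triangular S" "M = P * S * Q" "\<forall>i<n. S $$ (i, i) = f i"
    using assms by (auto simp: triangularized_by_def)
  have "c \<cdot>\<^sub>m M = P * (c \<cdot>\<^sub>m S) * Q"
    using P Q S by (simp add: mult_smult_distrib mult_smult_assoc_mat[of _ n n _ n])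
  moreover have "upper_triangular (c \<cdot>\<^sub>m S)"
    using S by (intro upper_triangularI) (auto simp: upper_triangularD)
  ultimately show ?thesis
    using S unfolding triangularized_by_def by (intro bexI[of _ "c \<cdot>\<^sub>m S"]) auto
qed

text \<open>The inner factor \<open>Q * P\<close> cancels, and diagonal entries multiply in a
  product of upper triangular matrices: in each diagonal sum only the middle term survives.\<close>

lemma triangularized_by_mult:
  assumes "triangularized_by P Q n M f" and "triangularized_by P Q n N g"
  shows "triangularized_by P Q n (M * N) (\<lambda>i. f i * g i)"
proof -
  obtain S T where S: "S \<in> carrier_mat n n" "upper_triangular S" "M = P * S * Q" "\<forall>i<n. S $$ (i, i) = f i"
    and T: "T \<in> carrier_mat n n" "upper_triangular T" "N = P * T * Q" "\<forall>i<n. T $$ (i, i) = g i"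
    using assms by (auto simp: triangularized_by_def)
  have "M * N = P * S * (Q * P) * (T * Q)"
    using P Q S T by (simp add: assoc_mult_mat[of _ n n _ n _ n])
  also have "\<dots> = P * (S * T) * Q"
    unfolding QP using P Q S T by (simp add: assoc_mult_mat[of _ n n _ n _ n])
  finally have MN: "M * N = P * (S * T) * Q" .
  have entry: "(S * T) $$ (i, j) = (\<Sum>k<n. S $$ (i, k) * T $$ (k, j))" if "i < n" "j < n" for i j
    using that S(1) T(1) by (auto simp: scalar_prod_def lessThan_atLeast0)
  have "upper_triangular (S * T)"
  proof (rule upper_triangularI)
    fix i j assume ij: "j < i" "i < dim_row (S * T)"
    have "S $$ (i, k) * T $$ (k, j) = 0" if "k < n" for k
      using that ij S T upper_triangularD[OF S(2), of k i] upper_triangularD[OF T(2), of j k]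
      by (cases "k < i") auto
    then show "(S * T) $$ (i, j) = 0"
      using ij S(1) by (simp add: entry sum.neutral)
  qed
  moreover have "(S * T) $$ (i, i) = f i * g i" if i: "i < n" for i
  proof -
    have "S $$ (i, k) * T $$ (k, i) = (if k = i then f i * g i else 0)" if "k < n" for k
      using that i S T upper_triangularD[OF S(2), of k i] upper_triangularD[OF T(2), of i k]
      by (cases k i rule: linorder_cases) auto
    then show ?thesis
      using i by (simp add: entry)
  qed
  ultimately show ?thesis
    using S T MN unfolding triangularized_by_def by (intro bexI[of _ "S * T"]) auto
qed

lemma sum_diag_mult_comm:
  fixes X Y :: "complex mat"
  assumes "X \<in> carrier_mat n n" and "Y \<in> carrier_mat n n"
  shows "(\<Sum>i<n. (X * Y) $$ (i, i)) = (\<Sum>i<n. (Y * X) $$ (i, i))"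
proof -
  have "(\<Sum>i<n. (X * Y) $$ (i, i)) = (\<Sum>i<n. \<Sum>k<n. X $$ (i, k) * Y $$ (k, i))"
    using assms by (auto simp: scalar_prod_def lessThan_atLeast0)
  also have "\<dots> = (\<Sum>i<n. \<Sum>k<n. X $$ (k, i) * Y $$ (i, k))"
    by (rule sum.swap)
  also have "\<dots> = (\<Sum>i<n. (Y * X) $$ (i, i))"
    using assms by (auto simp: scalar_prod_def lessThan_atLeast0 mult.commute)
  finally show ?thesis .
qed

text \<open>The trace is cyclic, so \<open>Q\<close> can be moved to the front, where it cancels
  \<open>P\<close> and leaves the triangular factor.\<close>

lemma triangularized_by_trace:
  assumes "triangularized_by P Q n M f"
  shows "(\<Sum>i<n. M $$ (i, i)) = (\<Sum>i<n. f i)"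
proof -
  obtain S where S: "S \<in> carrier_mat n n" "M = P * S * Q" "\<forall>i<n. S $$ (i, i) = f i"
    using assms by (auto simp: triangularized_by_def)
  have "(\<Sum>i<n. M $$ (i, i)) = (\<Sum>i<n. (Q * (P * S)) $$ (i, i))"
    unfolding S(2) using P Q S(1) by (intro sum_diag_mult_comm) auto
  also have "Q * (P * S) = S"
    using P Q S(1) QP by (simp add: assoc_mult_mat[of _ n n _ n _ n, symmetric])
  finally show ?thesis
    using S(3) by simp
qed

section \<open>Real symmetric matrices with at most one nonzero eigenvalue\<close>

text \<open>The trace of the square of a real symmetric matrix is the sum of the squares of its
  entries. It is also the sum of the squared eigenvalues, here zero.\<close>

lemma symmetric_triangularized_zero:
  fixes c :: "nat \<Rightarrow> nat \<Rightarrow> real"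
  assumes tri: "triangularized_by P Q n M f" and f: "\<And>i. i < n \<Longrightarrow> f i = 0"
    and M: "\<And>i j. i < n \<Longrightarrow> j < n \<Longrightarrow> M $$ (i, j) = of_real (c i j)"
    and sym: "\<And>i j. i < n \<Longrightarrow> j < n \<Longrightarrow> c i j = c j i"
    and "i < n" "j < n"
  shows "c i j = 0"
proof -
  have car: "M \<in> carrier_mat n n"
    using tri by (rule triangularized_by_carrier)
  have "(M * M) $$ (i, i) = of_real (\<Sum>k<n. (c i k)\<^sup>2)" if "i < n" for i
    using that car by (auto simp: scalar_prod_def lessThan_atLeast0 M power2_eq_square
        intro!: sum.cong dest: sym)
  then have "of_real (\<Sum>i<n. \<Sum>k<n. (c i k)\<^sup>2) = (\<Sum>i<n. (M * M) $$ (i, i))"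
    by simp
  also have "\<dots> = 0"
    using triangularized_by_trace[OF triangularized_by_mult[OF tri tri]] f by simp
  finally have "(\<Sum>i<n. \<Sum>k<n. (c i k)\<^sup>2) = 0"
    unfolding of_real_eq_0_iff .
  then have "(\<Sum>k<n. (c i k)\<^sup>2) = 0"
    using \<open>i < n\<close> by (subst (asm) sum_nonneg_eq_0_iff) (auto intro: sum_nonneg)
  then show ?thesis
    using \<open>j < n\<close> by (subst (asm) sum_nonneg_eq_0_iff) auto
qed

text \<open>Such a matrix satisfies M^2 = m M with m its trace. By Cauchy-Schwarz its principal 2x2
  minors are nonnegative when m is nonzero, and they sum to tr(M)^2 - tr(M^2) = 0.\<close>

lemma symmetric_minors_zero:
  fixes b :: "nat \<Rightarrow> nat \<Rightarrow> real"
  assumes tri: "triangularized_by P Q n M f" and f: "card {i \<in> {..<n}. f i \<noteq> 0} \<le> 1"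
    and M: "\<And>i j. i < n \<Longrightarrow> j < n \<Longrightarrow> M $$ (i, j) = of_real (b i j)"
    and sym: "\<And>i j. i < n \<Longrightarrow> j < n \<Longrightarrow> b i j = b j i"
    and "i < n" "j < n"
  shows "(b i j)\<^sup>2 = b i i * b j j"
proof -
  have car: "M \<in> carrier_mat n n"
    using tri by (rule triangularized_by_carrier)
  define m where "m = (\<Sum>i<n. b i i)"
  have tr: "of_real m = (\<Sum>i<n. f i)"
    using triangularized_by_trace[OF tri] by (simp add: M m_def)
  \<comment> \<open>A nonzero eigenvalue is the only one, hence equals the trace; so every
    eigenvalue is a root of x^2 - m x.\<close>
  have f2: "f i * f i = of_real m * f i" if "i < n" for i
  proof (cases "f i = 0")
    case False
    have "\<forall>k \<in> {i \<in> {..<n}. f i \<noteq> 0}. \<forall>l \<in> {i \<in> {..<n}. f i \<noteq> 0}. k = l"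
      using f by (subst (asm) One_nat_def, subst (asm) card_le_Suc0_iff_eq) auto
    then have "f k = 0" if "k < n" "k \<noteq> i" for k
      using that False \<open>i < n\<close> by blast
    then have "(\<Sum>k<n. f k) = f i"
      using \<open>i < n\<close> by (subst sum.mono_neutral_right[of _ "{i}"]) auto
    then show ?thesis
      using tr by simp
  qed simp
  have MM: "(M * M) $$ (i, j) = of_real (\<Sum>k<n. b i k * b k j)" if "i < n" "j < n" for i j
    using that car by (auto simp: scalar_prod_def lessThan_atLeast0 M)
  \<comment> \<open>The entries of M^2 - m M, a real symmetric matrix all of whose eigenvalues
    vanish by \<open>f2\<close>.\<close>
  define c where "c i j = (\<Sum>k<n. b i k * b k j) - m * b i j" for i j
  have square: "(\<Sum>k<n. b i k * b k j) = m * b i j" if "i < n" "j < n" for i j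
  proof -
    have "c i j = 0"
    proof (rule symmetric_triangularized_zero[OF triangularized_by_add[OF triangularized_by_mult[OF tri tri]
            triangularized_by_smult[OF tri, of "- of_real m"]] _ _ _ that])
      fix i j assume ij: "i < n" "j < n"
      show "(M * M + - of_real m \<cdot>\<^sub>m M) $$ (i, j) = of_real (c i j)"
        using ij car MM[OF ij] by (simp add: c_def M)
      have "(\<Sum>k<n. b i k * b k j) = (\<Sum>k<n. b j k * b k i)"
        using ij by (intro sum.cong) (auto simp: sym mult.commute)
      then show "c i j = c j i"
        using ij by (simp add: c_def sym)
    qed (simp add: f2)
    then show ?thesis by (simp add: c_def)
  qed
  have square': "(\<Sum>k<n. b i k * b j k) = m * b i j" if "i < n" "j < n" for i j
    using square[OF that] that sym by simp
  \<comment> \<open>Rows i and j have inner product m \<open>b i j\<close> and squared norms m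
    \<open>b i i\<close> and m \<open>b j j\<close>. The common factor m^2 stays until m is known to
    be nonzero.\<close>
  have le: "m\<^sup>2 * (b i j)\<^sup>2 \<le> m\<^sup>2 * (b i i * b j j)" if "i < n" "j < n" for i j
  proof -
    have "(\<Sum>k<n. b i k * b j k)\<^sup>2 \<le> (\<Sum>k<n. (b i k)\<^sup>2) * (\<Sum>k<n. (b j k)\<^sup>2)"
      by (rule Cauchy_Schwarz_ineq_sum)
    then show ?thesis
      using square'[OF that] square'[of i i] square'[of j j] that
      by (simp add: power2_eq_square mult_ac)
  qed
  have total: "(\<Sum>i<n. \<Sum>j<n. b i i * b j j - (b i j)\<^sup>2) = 0"
  proof -
    have "(\<Sum>i<n. \<Sum>j<n. (b i j)\<^sup>2) = (\<Sum>i<n. m * b i i)"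
      using square' by (intro sum.cong) (auto simp: power2_eq_square)
    also have "\<dots> = m * m"
      by (simp add: m_def sum_distrib_left)
    also have "\<dots> = (\<Sum>i<n. \<Sum>j<n. b i i * b j j)"
      by (simp add: m_def sum_product)
    finally show ?thesis
      by (simp add: sum_subtractf)
  qed
  show ?thesis
  proof (cases "m = 0")
    case True
    \<comment> \<open>The squared norm of row i is m \<open>b i i\<close>, which is zero here, so
      the whole matrix vanishes.\<close>
    have "b i k = 0" if "i < n" "k < n" for i k
      using square'[OF that(1) that(1)] True that(2)
      by (simp add: power2_eq_square[symmetric] sum_nonneg_eq_0_iff)
    then show ?thesis
      using \<open>i < n\<close> \<open>j < n\<close> by simp
  next
    case False
    then have nonneg: "0 \<le> b i i * b j j - (b i j)\<^sup>2" if "i < n" "j < n" for i j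
      using le[OF that] by simp
    have "(\<Sum>j<n. b i i * b j j - (b i j)\<^sup>2) = 0"
      using total \<open>i < n\<close> nonneg by (subst (asm) sum_nonneg_eq_0_iff) (auto intro!: sum_nonneg)
    then show ?thesis
      using \<open>i < n\<close> \<open>j < n\<close> nonneg by (subst (asm) sum_nonneg_eq_0_iff) auto
  qed
qed

end

text \<open>Here \<open>b\<close> gives the entries of A^2 + 2A, whose eigenvalues are e (e + 2) for
  the eigenvalues e of A. These vanish exactly for e = 0 and e = -2, so at most one of them is
  nonzero.\<close>

lemma symmetric_matrix_minors:
  fixes A :: "complex mat" and a :: "nat \<Rightarrow> nat \<Rightarrow> real"
  assumes A: "A = mat n n (\<lambda>(i, j). of_real (a i j))"
    and sym: "\<And>i j. i < n \<Longrightarrow> j < n \<Longrightarrow> a i j = a j i"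
    and ev: "size {# x \<in># eigenvalue_mset A. x \<noteq> - 2 \<and> x \<noteq> 0 #} \<le> 1"
    and "i < n" "j < n"
  defines "b \<equiv> \<lambda>i j. (\<Sum>k<n. a i k * a k j) + 2 * a i j"
  shows "(b i j)\<^sup>2 = b i i * b j j"
proof -
  have car: "A \<in> carrier_mat n n" using A by simp
  obtain es where es: "char_poly A = (\<Prod>e\<leftarrow>es. [:- e, 1:])" "length es = n"
    using char_poly_factorized[OF car] by blast
  obtain T P Q where "schur_decomposition A es = (T, P, Q)"
    by (metis prod_cases3)
  from schur_decomposition[OF car es(1) this]
  have wit: "similar_mat_wit A T P Q" and T: "upper_triangular T" "diag_mat T = es"
    by auto
  note w = similar_mat_witD2[OF car wit]
  have tri: "triangularized_by P Q n A (\<lambda>i. es ! i)"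
    unfolding triangularized_by_def using w T by (intro bexI[of _ T]) (auto simp: diag_mat_def)
  \<comment> \<open>The three conditions imposed on the change of basis: both carriers and
    \<open>Q * P = 1\<^sub>m n\<close>.\<close>
  note ops = w(6) w(7) w(2)
  let ?f = "\<lambda>i. es ! i * es ! i + 2 * es ! i"
  have "eigenvalue_mset A = mset es"
    unfolding eigenvalue_mset_def es(1)
  proof (induction es)
    case (Cons e es)
    have "(\<Prod>e\<leftarrow>es. [:- e, 1:]) \<noteq> 0"
      by (auto simp: prod_list_zero_iff)
    then show ?case
      using Cons by (simp add: proots_mult del: mult_pCons_left)
  qed simp
  then have "size {# x \<in># mset es. x \<noteq> - 2 \<and> x \<noteq> 0 #} \<le> 1"
    using ev by simp
  also have "size {# x \<in># mset es. x \<noteq> - 2 \<and> x \<noteq> 0 #} = length (filter (\<lambda>x. x \<noteq> - 2 \<and> x \<noteq> 0) es)"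
    by (simp flip: mset_filter)
  also have "\<dots> = card {i. i < n \<and> es ! i \<noteq> - 2 \<and> es ! i \<noteq> 0}"
    by (simp add: length_filter_conv_card es(2))
  also have "{i. i < n \<and> es ! i \<noteq> - 2 \<and> es ! i \<noteq> 0} = {i \<in> {..<n}. ?f i \<noteq> 0}"
  proof -
    have "?f i = es ! i * (es ! i + 2)" for i
      by (simp add: algebra_simps)
    then show ?thesis
      by (auto simp: add_eq_0_iff2)
  qed
  finally have card: "card {i \<in> {..<n}. ?f i \<noteq> 0} \<le> 1" .
  show ?thesis
  proof (rule symmetric_minors_zero[OF ops triangularized_by_add[OF ops triangularized_by_mult[OF ops tri tri]
          triangularized_by_smult[OF ops tri, of 2]] card _ _ \<open>i < n\<close> \<open>j < n\<close>])
    fix i j assume ij: "i < n" "j < n"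
    show "(A * A + 2 \<cdot>\<^sub>m A) $$ (i, j) = of_real (b i j)"
      using ij by (simp add: A b_def scalar_prod_def lessThan_atLeast0)
    have "(\<Sum>k<n. a i k * a k j) = (\<Sum>k<n. a j k * a k i)"
      using ij by (intro sum.cong) (auto simp: sym mult.commute)
    then show "b i j = b j i"
      using ij by (simp add: b_def sym)
  qed
qed

section \<open>Isomorphisms onto the explicit graphs\<close>

text \<open>Arcs are pairs of vertices, so a vertex bijection determines the arc map,
  \<open>map_prod f f\<close>.\<close>

lemma isomorphicI:
  assumes "pair_graph G" and "bij_betw f (pverts G) (pverts H)"
    and "parcs H = map_prod f f ` parcs G"
  shows "isomorphic G H"
proof -
  interpret pair_graph G by fact
  let ?h = "\<lparr> iso_verts = f, iso_arcs = map_prod f f, iso_head = snd, iso_tail = fst \<rparr>"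
  have inj: "inj_on f (pverts G)" and img: "f ` pverts G = pverts H"
    using assms(2) by (auto simp: bij_betw_def)
  have "inj_on (map_prod f f) (parcs G)"
    by (rule inj_on_subset[OF map_prod_inj_on[OF inj inj]]) (auto dest: arc_fst_in_verts arc_snd_in_verts)
  then have "pre_digraph.digraph_isomorphism (with_proj G) ?h"
    using inj by (auto simp: digraph_isomorphism_def wf_digraph_wp_iff)
  moreover have "with_proj H = app_iso ?h (with_proj G)"
    by (simp add: app_iso_def with_proj_def img assms(3))
  ultimately show ?thesis
    unfolding isomorphic_def digraph_iso_def by blast
qed

lemma isomorphic_copies_single_vertex:
  assumes "pair_graph G" and "parcs G = {}"
  shows "isomorphic G (copies (card (pverts G)) single_vertex)"
proof -
  interpret pair_graph G by fact
  obtain h where h: "bij_betw h (pverts G) {..<card (pverts G)}"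
    using ex_bij_betw_finite_nat[OF pair_finite_verts] by (auto simp: lessThan_atLeast0)
  show ?thesis
  proof (rule isomorphicI[OF assms(1)])
    show "bij_betw (\<lambda>x. (h x, ())) (pverts G) (pverts (copies (card (pverts G)) single_vertex))"
      using h by (auto simp: bij_betw_def copies_def single_vertex_def inj_on_def)
  qed (use assms(2) in \<open>auto simp: copies_def single_vertex_def\<close>)
qed

text \<open>An isomorphism arises from numbering the vertices inside each class and, separately,
  those outside all classes, which are isolated by \<open>arcs\<close>.\<close>

lemma isomorphic_complete_multipartite_isolated:
  assumes "pair_graph G" and sub: "\<Union> (set cs) \<subseteq> pverts G"
    and disj: "\<And>i j. i < length cs \<Longrightarrow> j < length cs \<Longrightarrow> i \<noteq> j \<Longrightarrow> cs ! i \<inter> cs ! j = {}"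
    and arcs: "parcs G = {(u, v). \<exists>i<length cs. \<exists>j<length cs. i \<noteq> j \<and> u \<in> cs ! i \<and> v \<in> cs ! j}"
  shows "isomorphic G (disjoint_union (complete_multipartite (map card cs))
    (copies (card (pverts G) - card (\<Union> (set cs))) single_vertex))"
proof -
  interpret pair_graph G by fact
  let ?W = "\<Union> (set cs)"
  let ?H = "disjoint_union (complete_multipartite (map card cs))
    (copies (card (pverts G) - card ?W) single_vertex)"
  have mem: "x \<in> ?W \<longleftrightarrow> (\<exists>i<length cs. x \<in> cs ! i)" for x
    by (metis Union_iff in_set_conv_nth)
  \<comment> \<open>\<open>idx x\<close> is the position of the class of x, unique because the
    classes are disjoint.\<close>
  then obtain idx where idx: "\<And>x. x \<in> ?W \<Longrightarrow> idx x < length cs \<and> x \<in> cs ! idx x"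
    by metis
  have idx_eq: "idx x = i" if "x \<in> cs ! i" "i < length cs" for x i
    using idx[of x] disj[of "idx x" i] that mem by blast
  have "finite (cs ! i)" if "i < length cs" for i
    using that sub by (intro finite_subset[OF _ pair_finite_verts]) (auto dest: nth_mem)
  then have "\<exists>g. bij_betw g (cs ! i) {..<card (cs ! i)}" if "i < length cs" for i
    using ex_bij_betw_finite_nat[of "cs ! i"] that by (auto simp: lessThan_atLeast0)
  then obtain g where g: "\<And>i. i < length cs \<Longrightarrow> bij_betw (g i) (cs ! i) {..<card (cs ! i)}"
    by metis
  have "card (pverts G - ?W) = card (pverts G) - card ?W"
    using sub by (intro card_Diff_subset finite_subset[OF _ pair_finite_verts]) auto
  then obtain h where h: "bij_betw h (pverts G - ?W) {..<card (pverts G) - card ?W}"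
    using ex_bij_betw_finite_nat[of "pverts G - ?W"] pair_finite_verts
    by (auto simp: lessThan_atLeast0)
  let ?e = "\<lambda>x. (idx x, g (idx x) x)"
  define f where "f x = (if x \<in> ?W then Inl (?e x) else Inr (h x, ()))" for x
  have e: "bij_betw ?e ?W (pverts (complete_multipartite (map card cs)))"
  proof (rule bij_betw_imageI)
    show "inj_on ?e ?W"
    proof (rule inj_onI)
      fix x y assume "x \<in> ?W" "y \<in> ?W" "?e x = ?e y"
      then show "x = y"
        using idx[of x] idx[of y] g[of "idx x"] by (auto simp: bij_betw_def dest: inj_onD)
    qed
    show "?e ` ?W = pverts (complete_multipartite (map card cs))"
    proof (intro equalityI subsetI)
      fix y assume "y \<in> ?e ` ?W"
      then obtain x where x: "x \<in> ?W" "y = ?e x" by blast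
      then have "g (idx x) x < card (cs ! idx x)"
        using idx[OF x(1)] bij_betw_apply[OF g] by blast
      then show "y \<in> pverts (complete_multipartite (map card cs))"
        using idx[OF x(1)] x(2) by (simp add: complete_multipartite_def Let_def)
    next
      fix y assume "y \<in> pverts (complete_multipartite (map card cs))"
      then obtain i j where y: "y = (i, j)" "i < length cs" "j < card (cs ! i)"
        by (auto simp: complete_multipartite_def Let_def)
      then have "j \<in> g i ` (cs ! i)"
        using g[of i] by (simp add: bij_betw_def)
      then obtain x where "x \<in> cs ! i" "g i x = j"
        by blast
      then show "y \<in> ?e ` ?W"
        using y idx_eq mem by (intro image_eqI[of _ _ x]) auto
    qed
  qed
  show ?thesis
  proof (rule isomorphicI[OF assms(1)])
    have "bij_betw f (?W \<union> (pverts G - ?W)) (Inl ` pverts (complete_multipartite (map card cs)) \<union>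
        Inr ` ({..<card (pverts G) - card ?W} \<times> {()}))"
    proof (rule bij_betw_combine)
      show "bij_betw f ?W (Inl ` pverts (complete_multipartite (map card cs)))"
      proof -
        have "bij_betw (Inl \<circ> ?e) ?W (Inl ` pverts (complete_multipartite (map card cs)))"
          using e by (rule bij_betw_trans) (simp add: bij_betw_def)
        then show ?thesis
          by (rule bij_betw_cong[THEN iffD1, rotated]) (simp add: f_def)
      qed
      show "bij_betw f (pverts G - ?W) (Inr ` ({..<card (pverts G) - card ?W} \<times> {()}))"
      proof -
        have "bij_betw ((\<lambda>i. Inr (i, ())) \<circ> h) (pverts G - ?W)
            (Inr ` ({..<card (pverts G) - card ?W} \<times> {()}))"
          using h by (rule bij_betw_trans) (auto simp: bij_betw_def inj_on_def)
        then show ?thesis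
          by (rule bij_betw_cong[THEN iffD1, rotated]) (simp add: f_def)
      qed
    qed auto
    moreover have "?W \<union> (pverts G - ?W) = pverts G"
      using sub by blast
    moreover have "pverts ?H = Inl ` pverts (complete_multipartite (map card cs)) \<union>
        Inr ` ({..<card (pverts G) - card ?W} \<times> {()})"
      by (simp add: disjoint_union_def copies_def single_vertex_def Plus_def)
    ultimately show "bij_betw f (pverts G) (pverts ?H)"
      by simp
    \<comment> \<open>In terms of \<open>idx\<close>, adjacency becomes inequality of first
      coordinates, as in \<open>complete_multipartite\<close>.\<close>
    have arcs': "parcs G = {(u, v). u \<in> ?W \<and> v \<in> ?W \<and> idx u \<noteq> idx v}"
    proof (intro equalityI subsetI)
      fix p assume "p \<in> parcs G"
      then obtain u v i j where "p = (u, v)" "i < length cs" "j < length cs" "i \<noteq> j"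
        "u \<in> cs ! i" "v \<in> cs ! j"
        unfolding arcs by blast
      then show "p \<in> {(u, v). u \<in> ?W \<and> v \<in> ?W \<and> idx u \<noteq> idx v}"
        using idx_eq mem by blast
    next
      fix p assume "p \<in> {(u, v). u \<in> ?W \<and> v \<in> ?W \<and> idx u \<noteq> idx v}"
      then show "p \<in> parcs G"
        unfolding arcs using idx by blast
    qed
    have "parcs (complete_multipartite (map card cs)) =
        {(u, v). u \<in> ?e ` ?W \<and> v \<in> ?e ` ?W \<and> fst u \<noteq> fst v}"
      using e by (simp add: complete_multipartite_def Let_def bij_betw_def)
    also have "\<dots> = map_prod ?e ?e ` parcs G"
      unfolding arcs' by (auto simp: image_def) blast
    finally have "parcs (complete_multipartite (map card cs)) = map_prod ?e ?e ` parcs G" .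
    moreover have "parcs ?H = map_prod Inl Inl ` parcs (complete_multipartite (map card cs))"
      by (auto simp: disjoint_union_def copies_def single_vertex_def)
    moreover have "map_prod f f ` parcs G = map_prod Inl Inl ` (map_prod ?e ?e ` parcs G)"
      unfolding image_image using arcs' by (intro image_cong) (auto simp: f_def)
    ultimately show "parcs ?H = map_prod f f ` parcs G"
      by simp
  qed
qed

section \<open>The equation for two class sizes\<close>

text \<open>Expanding cancels s^2 and leaves 4s + 4 = (p + q) s + p q. If p + q < 4 the right side
  is too small; if p + q = 4 then p q = 4; if p + q > 4 then p q \<ge> p + q - 1 \<ge> 4 forces s =
  0, p + q = 5 and p q = 4.\<close>

lemma class_sizes:
  fixes p q s :: nat
  assumes "(s + 2)\<^sup>2 = (s + q) * (s + p)" and "0 < p" "0 < q"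
  shows "p = 2 \<and> q = 2 \<or> s = 0 \<and> (p = 1 \<and> q = 4 \<or> p = 4 \<and> q = 1)"
proof -
  have eq: "4 * s + 4 = (p + q) * s + p * q"
    using assms(1) by (simp add: power2_eq_square algebra_simps)
  obtain a b where ab: "p = Suc a" "q = Suc b"
    using assms(2,3) gr0_implies_Suc by blast
  consider "p + q < 4" | "p + q = 4" | "4 < p + q" by linarith
  then show ?thesis
  proof cases
    case 1
    then have "a + b < 2" using ab by simp
    then consider "a = 0" "b = 0" | "a = 0" "b = 1" | "a = 1" "b = 0" by linarith
    then show ?thesis using eq ab by cases auto
  next
    case 2
    then have "a + b = 2" using ab by simp
    then consider "a = 0" "b = 2" | "a = 1" "b = 1" | "a = 2" "b = 0" by linarith
    then show ?thesis using eq ab by cases auto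
  next
    case 3
    then have "5 * s \<le> (p + q) * s" by (intro mult_right_mono) auto
    moreover have "p * q = a * b + (a + b) + 1" using ab by simp
    moreover have "a + b \<ge> 3" using 3 ab by simp
    ultimately have "s = 0" "a * b = 0" "a + b = 3" using eq by linarith+
    then show ?thesis using ab by auto
  qed
qed

section \<open>Structure of graphs with the codegree identity\<close>

text \<open>The combinatorial content of the spectral hypothesis: the vanishing of the principal 2x2
  minors of A^2 + 2A, written over the naturals.\<close>

locale square_codegree_graph = pair_graph +
  assumes codegree: "\<And>u v. u \<in> pverts G \<Longrightarrow> v \<in> pverts G \<Longrightarrow>
    (card (parcs G `` {u} \<inter> parcs G `` {v}) + (if (u, v) \<in> parcs G then 2 else 0))\<^sup>2 =
    card (parcs G `` {u}) * card (parcs G `` {v})"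
begin

abbreviation nbhd :: "'a \<Rightarrow> 'a set"
  where "nbhd u \<equiv> parcs G `` {u}"

definition nonisolated :: "'a set"
  where "nonisolated = {u. nbhd u \<noteq> {}}"

text \<open>These sets turn out to be the parts of the complete multipartite graph on
  \<open>nonisolated\<close>.\<close>

definition twins :: "'a \<Rightarrow> 'a set"
  where "twins u = {v \<in> nonisolated. nbhd v = nbhd u}"

lemma arc_sym: "(u, v) \<in> parcs G \<longleftrightarrow> (v, u) \<in> parcs G"
  using pair_sym_arcs by (auto simp: symmetric_def sym_def)

lemma loopfree: "(u, u) \<notin> parcs G"
  using pair_no_loops by fastforce

lemma nonisolated_subset: "nonisolated \<subseteq> pverts G"
  by (auto simp: nonisolated_def dest: arc_fst_in_verts)

lemma nbhd_subset: "nbhd u \<subseteq> nonisolated"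
  by (auto simp: nonisolated_def arc_sym)

lemma finite_nonisolated: "finite nonisolated"
  using nonisolated_subset pair_finite_verts by (rule finite_subset)

lemma finite_nbhd: "finite (nbhd u)"
  using nbhd_subset finite_nonisolated by (rule finite_subset)

text \<open>The number of common neighbours is at most each of the two degrees, and its square is
  their product. As the degrees are positive, all three numbers agree, so both neighbourhoods equal
  their intersection.\<close>

lemma nonadjacent_imp_nbhd_eq:
  assumes u: "u \<in> nonisolated" and v: "v \<in> nonisolated" and "(u, v) \<notin> parcs G"
  shows "nbhd u = nbhd v"
proof -
  let ?c = "card (nbhd u \<inter> nbhd v)"
  have c: "?c\<^sup>2 = card (nbhd u) * card (nbhd v)"
    using codegree[of u v] assms nonisolated_subset by auto
  have le: "?c \<le> card (nbhd u)" "?c \<le> card (nbhd v)"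
    by (auto intro!: card_mono finite_nbhd)
  have pos: "0 < card (nbhd u)" "0 < card (nbhd v)"
    using u v by (auto simp: nonisolated_def card_gt_0_iff finite_nbhd)
  have "?c = card (nbhd u)"
  proof (rule ccontr)
    assume "?c \<noteq> card (nbhd u)"
    then have "?c * card (nbhd v) < card (nbhd u) * card (nbhd v)"
      using le pos by simp
    moreover have "?c * ?c \<le> ?c * card (nbhd v)"
      using le by simp
    ultimately show False using c unfolding power2_eq_square by linarith
  qed
  moreover from this have "?c = card (nbhd v)"
    using c pos by (auto simp: power2_eq_square)
  ultimately show ?thesis
    using card_subset_eq[OF finite_nbhd, of "nbhd u \<inter> nbhd v" u]
      card_subset_eq[OF finite_nbhd, of "nbhd u \<inter> nbhd v" v] by (metis Int_lower1 Int_lower2)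
qed

text \<open>Adjacent vertices are never twins, since a shared neighbourhood would give a loop;
  nonadjacent nonisolated vertices always are. Thus nonadjacency is an equivalence relation on
  \<open>nonisolated\<close>.\<close>

lemma twins_eq:
  assumes "u \<in> nonisolated"
  shows "twins u = nonisolated - nbhd u"
proof (intro equalityI subsetI)
  fix v assume "v \<in> twins u"
  then show "v \<in> nonisolated - nbhd u"
    using loopfree[of v] unfolding twins_def by blast
next
  fix v assume "v \<in> nonisolated - nbhd u"
  then show "v \<in> twins u"
    using nonadjacent_imp_nbhd_eq[OF assms, of v] by (simp add: twins_def)
qed

lemma self_in_twins: "u \<in> nonisolated \<Longrightarrow> u \<in> twins u"
  by (simp add: twins_def)

lemma finite_twins: "finite (twins u)"
  using finite_nonisolated by (simp add: twins_def)

text \<open>Each neighbourhood is the complement of a twin class, so the two degrees are s + q and s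
  + p, with p and q the class sizes of u and v and s the number of common neighbours. The codegree
  identity is then the equation of \<open>class_sizes\<close>.\<close>

lemma twins_sizes:
  assumes "(u, v) \<in> parcs G"
  shows "card (twins u) = 2 \<and> card (twins v) = 2 \<or>
    nonisolated = twins u \<union> twins v \<and>
      (card (twins u) = 1 \<and> card (twins v) = 4 \<or> card (twins u) = 4 \<and> card (twins v) = 1)"
proof -
  have uv: "u \<in> nonisolated" "v \<in> nonisolated"
    using assms nbhd_subset arc_sym by blast+
  let ?s = "card (nbhd u \<inter> nbhd v)"
  have disj: "twins u \<inter> twins v = {}"
    using assms loopfree[of v] unfolding twins_def by blast
  have "nbhd u = (nbhd u \<inter> nbhd v) \<union> twins v" "nbhd v = (nbhd u \<inter> nbhd v) \<union> twins u"
    using disj twins_eq[OF uv(1)] twins_eq[OF uv(2)] nbhd_subset by blast+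
  moreover have "(nbhd u \<inter> nbhd v) \<inter> twins v = {}" "(nbhd u \<inter> nbhd v) \<inter> twins u = {}"
    using twins_eq uv by auto
  ultimately have "card (nbhd u) = ?s + card (twins v)" "card (nbhd v) = ?s + card (twins u)"
    by (metis card_Un_disjoint finite_Int finite_nbhd finite_twins)+
  then have "(?s + 2)\<^sup>2 = (?s + card (twins v)) * (?s + card (twins u))"
    using codegree[of u v] assms uv nonisolated_subset by auto
  moreover have "0 < card (twins u)" "0 < card (twins v)"
    using uv self_in_twins finite_twins by (auto simp: card_gt_0_iff)
  \<comment> \<open>The common neighbours are exactly the nonisolated vertices outside both
    classes.\<close>
  moreover have "nonisolated = twins u \<union> twins v" if "?s = 0"
  proof -
    have "nbhd u \<inter> nbhd v = {}" using that finite_nbhd by simp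
    then show ?thesis using twins_eq uv nbhd_subset by auto
  qed
  moreover from calculation(1-3) have
    "card (twins u) = 2 \<and> card (twins v) = 2 \<or>
      ?s = 0 \<and> (card (twins u) = 1 \<and> card (twins v) = 4 \<or> card (twins u) = 4 \<and> card (twins v) = 1)"
    by (rule class_sizes)
  ultimately show ?thesis
    by metis
qed

text \<open>Different twin classes are disjoint, and two nonisolated vertices are adjacent exactly
  when their classes differ. Listing each class once makes different positions mean different
  classes.\<close>

lemma isomorphic_twin_classes:
  assumes "distinct cs" and "set cs = twins ` nonisolated"
  shows "isomorphic G (disjoint_union (complete_multipartite (map card cs))
    (copies (card (pverts G) - card nonisolated) single_vertex))"
proof -
  have un: "\<Union> (set cs) = nonisolated"
    unfolding assms(2) by (auto simp: twins_def)
  have mem: "\<exists>w \<in> nonisolated. cs ! i = twins w" if "i < length cs" for i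
    using that nth_mem[OF that] assms(2) by auto
  show ?thesis
    unfolding un[symmetric]
  proof (rule isomorphic_complete_multipartite_isolated)
    show "pair_graph G" ..
    show "\<Union> (set cs) \<subseteq> pverts G"
      unfolding un by (rule nonisolated_subset)
    show disj: "cs ! i \<inter> cs ! j = {}" if "i < length cs" "j < length cs" "i \<noteq> j" for i j
    proof -
      have "cs ! i \<noteq> cs ! j"
        using that assms(1) by (simp add: nth_eq_iff_index_eq)
      then show ?thesis
        using mem[OF that(1)] mem[OF that(2)] by (auto simp: twins_def)
    qed
    show "parcs G = {(u, v). \<exists>i<length cs. \<exists>j<length cs. i \<noteq> j \<and> u \<in> cs ! i \<and> v \<in> cs ! j}"
    proof (intro equalityI subsetI)
      fix e assume "e \<in> parcs G"
      then obtain u v where e: "e = (u, v)" "(u, v) \<in> parcs G" by (cases e) auto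
      then have uv: "u \<in> nonisolated" "v \<in> nonisolated"
        using nbhd_subset arc_sym by blast+
      then obtain i j where ij: "i < length cs" "j < length cs" "cs ! i = twins u" "cs ! j = twins v"
        by (metis assms(2) imageI in_set_conv_nth)
      moreover have "twins u \<noteq> twins v"
        using self_in_twins[OF uv(2)] e(2) loopfree[of v] by (auto simp: twins_def)
      ultimately have "i \<noteq> j" "u \<in> cs ! i" "v \<in> cs ! j"
        using self_in_twins uv by auto
      then show "e \<in> {(u, v). \<exists>i<length cs. \<exists>j<length cs. i \<noteq> j \<and> u \<in> cs ! i \<and> v \<in> cs ! j}"
        using e(1) ij(1,2) by blast
    next
      fix e assume "e \<in> {(u, v). \<exists>i<length cs. \<exists>j<length cs. i \<noteq> j \<and> u \<in> cs ! i \<and> v \<in> cs ! j}"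
      then obtain u v i j where e: "e = (u, v)" and ij: "i < length cs" "j < length cs" "i \<noteq> j"
        and uv: "u \<in> cs ! i" "v \<in> cs ! j"
        by auto
      obtain w where w: "w \<in> nonisolated" "cs ! i = twins w" using mem[OF ij(1)] by blast
      have "u \<in> nonisolated" "v \<in> nonisolated"
        using uv ij mem by (auto simp: twins_def)
      moreover have "nbhd u \<noteq> nbhd v"
      proof
        assume "nbhd u = nbhd v"
        then have "v \<in> cs ! i"
          using uv(1) w(2) \<open>v \<in> nonisolated\<close> by (simp add: twins_def)
        then show False
          using disj[OF ij] uv(2) by blast
      qed
      ultimately show "e \<in> parcs G"
        using nonadjacent_imp_nbhd_eq e by blast
    qed
  qed
qed

lemma classification:
  "isomorphic G (copies (card (pverts G)) single_vertex)
    \<or> 5 \<le> card (pverts G) \<and>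
        isomorphic G (disjoint_union (complete_bipartite 1 4) (copies (card (pverts G) - 5) single_vertex))
    \<or> (\<exists>k\<ge>2. 2 * k \<le> card (pverts G) \<and>
        isomorphic G (disjoint_union (cocktail_party k) (copies (card (pverts G) - 2 * k) single_vertex)))"
proof -
  have le: "card nonisolated \<le> card (pverts G)"
    using nonisolated_subset pair_finite_verts by (intro card_mono)
  \<comment> \<open>The three outcomes: no arcs, all classes of size 2, or a class of another size,
    which by \<open>twins_sizes\<close> leaves just two classes, of sizes 1 and 4.\<close>
  consider "parcs G = {}"
    | "parcs G \<noteq> {}" "\<forall>u \<in> nonisolated. card (twins u) = 2"
    | u where "u \<in> nonisolated" "card (twins u) \<noteq> 2"
    by blast
  then show ?thesis
  proof cases
    case 1
    then show ?thesis
      using isomorphic_copies_single_vertex pair_graph by blast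
  next
    case 2
    obtain cs where cs: "distinct cs" "set cs = twins ` nonisolated"
      using finite_distinct_list[of "twins ` nonisolated"] finite_nonisolated by auto
    have "card (cs ! i) = 2" if "i < length cs" for i
      using nth_mem[OF that] 2(2) cs(2) by auto
    then have map: "map card cs = replicate (length cs) 2"
      by (intro nth_equalityI) auto
    have "card nonisolated = card (\<Union> (twins ` nonisolated))"
      by (rule arg_cong[of _ _ card]) (auto simp: twins_def)
    also have "\<dots> = (\<Sum>c \<in> twins ` nonisolated. card c)"
      using finite_twins by (intro card_Union_disjoint) (auto simp: disjoint_def pairwise_def twins_def disjnt_def)
    also have "\<dots> = (\<Sum>c \<in> twins ` nonisolated. 2)"
      using 2(2) by (intro sum.cong) auto
    also have "\<dots> = 2 * length cs"
      using distinct_card[OF cs(1)] cs(2) by simp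
    finally have W: "card nonisolated = 2 * length cs" .
    \<comment> \<open>The ends of an arc lie in different classes, which gives at least two
      parts.\<close>
    obtain u v where uv: "(u, v) \<in> parcs G" using 2(1) by auto
    then have "u \<in> nonisolated" "v \<in> nonisolated"
      using nbhd_subset arc_sym by blast+
    then have "twins u \<noteq> twins v"
      using self_in_twins[of v] uv loopfree[of v] by (auto simp: twins_def)
    then have "card {twins u, twins v} = 2" by simp
    moreover have "card {twins u, twins v} \<le> card (set cs)"
      using \<open>u \<in> nonisolated\<close> \<open>v \<in> nonisolated\<close> cs(2) finite_nonisolated by (intro card_mono) auto
    ultimately have "2 \<le> length cs"
      using card_length[of cs] by linarith
    then show ?thesis
      using isomorphic_twin_classes[OF cs] le unfolding map W cocktail_party_def by auto
  next
    case (3 u)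
    obtain v where uv: "(u, v) \<in> parcs G"
      using 3(1) by (auto simp: nonisolated_def)
    \<comment> \<open>The arc is reversed if necessary, so that the class of size 1 comes
      first.\<close>
    obtain x y where xy: "(x, y) \<in> parcs G" "nonisolated = twins x \<union> twins y"
      "card (twins x) = 1" "card (twins y) = 4"
      using twins_sizes[OF uv] 3(2) uv arc_sym by (metis Un_commute)
    have nonis: "x \<in> nonisolated" "y \<in> nonisolated"
      using nbhd_subset arc_sym xy(1) by blast+
    have "twins ` nonisolated = {twins x, twins y}"
    proof (intro equalityI subsetI)
      fix c assume "c \<in> twins ` nonisolated"
      then obtain w where "c = twins w" "w \<in> twins x \<union> twins y"
        using xy(2) by blast
      then show "c \<in> {twins x, twins y}"
        by (auto simp: twins_def)
    qed (use nonis in auto)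
    moreover have "twins x \<noteq> twins y" using xy(3,4) by auto
    ultimately have "isomorphic G (disjoint_union (complete_multipartite (map card [twins x, twins y]))
      (copies (card (pverts G) - card nonisolated) single_vertex))"
      by (intro isomorphic_twin_classes) auto
    moreover have "card nonisolated = 5"
    proof -
      have "twins x \<inter> twins y = {}"
        using \<open>twins x \<noteq> twins y\<close> by (auto simp: twins_def)
      then show ?thesis
        unfolding xy(2) using finite_twins xy(3,4) by (simp add: card_Un_disjoint)
    qed
    ultimately show ?thesis
      using le xy(3,4) by (simp add: complete_bipartite_def)
  qed
qed

end

section \<open>From the spectrum to the classification\<close>

theorem theorem3:
  fixes G :: "'a pair_pre_digraph" and vs :: "'a list" and n :: nat
  assumes "pair_graph G"
    and "card (pverts G) = n"
    and "distinct vs" and "set vs = pverts G"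
    and "size {# x \<in># eigenvalue_mset (adjacency_matrix G vs). x \<noteq> - 2 \<and> x \<noteq> 0 #} \<le> 1"
  shows "isomorphic G (copies n single_vertex)
    \<or> 5 \<le> n \<and> isomorphic G (disjoint_union (complete_bipartite 1 4) (copies (n - 5) single_vertex))
    \<or> (\<exists>k\<ge>2. 2 * k \<le> n \<and>
        isomorphic G (disjoint_union (cocktail_party k) (copies (n - 2 * k) single_vertex)))"
proof -
  interpret pair_graph G by fact
  have len: "length vs = n"
    using distinct_card[OF assms(3)] assms(2,4) by simp
  define a :: "nat \<Rightarrow> nat \<Rightarrow> real"
    where "a i j = of_bool ((vs ! i, vs ! j) \<in> parcs G)" for i j
  have sym: "(u, v) \<in> parcs G \<longleftrightarrow> (v, u) \<in> parcs G" for u v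
    using pair_sym_arcs by (auto simp: symmetric_def sym_def)
  \<comment> \<open>The entries of A^2 count walks of length two, that is, common neighbours; on the
    diagonal they are the degrees.\<close>
  have walks: "(\<Sum>k<n. a i k * a k j) = real (card (parcs G `` {vs ! i} \<inter> parcs G `` {vs ! j}))"
    for i j
  proof -
    let ?C = "parcs G `` {vs ! i} \<inter> parcs G `` {vs ! j}"
    have "(\<Sum>k<n. a i k * a k j) = (\<Sum>k<n. of_bool (vs ! k \<in> ?C))"
      using sym by (intro sum.cong) (auto simp: a_def)
    also have "\<dots> = (\<Sum>x \<in> pverts G. of_bool (x \<in> ?C))"
      using assms(3,4) len by (intro sum.reindex_bij_betw bij_betw_nth) auto
    also have "\<dots> = real (card (pverts G \<inter> ?C))"
      using pair_finite_verts by (auto intro!: arg_cong[of _ _ card])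
    also have "pverts G \<inter> ?C = ?C"
      by (auto dest: arc_snd_in_verts)
    finally show ?thesis .
  qed
  have mat: "adjacency_matrix G vs = mat n n (\<lambda>(i, j). complex_of_real (a i j))"
    unfolding adjacency_matrix_def len by (rule cong_mat) (auto simp: a_def)
  interpret SCG: square_codegree_graph G
  proof unfold_locales
    fix u v assume "u \<in> pverts G" "v \<in> pverts G"
    then obtain i j where ij: "i < n" "j < n" "u = vs ! i" "v = vs ! j"
      by (metis assms(4) in_set_conv_nth len)
    have a_sym: "a k l = a l k" for k l
      using sym by (simp add: a_def)
    have diag: "a k k = 0" for k
      using pair_no_loops by (fastforce simp: a_def)
    \<comment> \<open>Since \<open>a\<close> has zero diagonal, the diagonal entries of A^2 + 2A are
      the degrees, and the vanishing minor is the codegree identity over the reals.\<close>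
    have "(real (card (parcs G `` {u} \<inter> parcs G `` {v})) + 2 * a i j)\<^sup>2 =
        real (card (parcs G `` {u})) * real (card (parcs G `` {v}))"
      using symmetric_matrix_minors[OF mat a_sym assms(5) ij(1,2)]
      by (simp add: walks diag ij(3,4))
    also have "real (card (parcs G `` {u} \<inter> parcs G `` {v})) + 2 * a i j =
        real (card (parcs G `` {u} \<inter> parcs G `` {v}) + (if (u, v) \<in> parcs G then 2 else 0))"
      by (simp add: a_def ij(3,4))
    finally show "(card (parcs G `` {u} \<inter> parcs G `` {v}) + (if (u, v) \<in> parcs G then 2 else 0))\<^sup>2 =
        card (parcs G `` {u}) * card (parcs G `` {v})"
      by (metis of_nat_eq_iff of_nat_mult of_nat_power)
  qed
  show ?thesis
    using SCG.classification unfolding assms(2) .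
qed

end
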